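(* Let $n\ge 2$, let $T$ be a regular solid simplex in $\mathbb{R}^n$ of internal radius $1$, and let $1\le k\le n-1$. Then the largest $k$-dimensional Euclidean balls contained in $T$ are those of radius $\sqrt{\frac{n(n+1)}{k(k+1)}}$ which lie in $k$-dimensional faces of $T$. That is, the maximum of the radii of the $k$-dimensional Euclidean balls contained in $T$ equals $\sqrt{\frac{n(n+1)}{k(k+1)}}$, and a $k$-dimensional Euclidean ball contained in $T$ has this maximal radius if and only if it has radius $\sqrt{\frac{n(n+1)}{k(k+1)}}$ and lies in a $k$-dimensional face of $T$.
   Context: A regular solid simplex in $\mathbb{R}^n$ is the convex hull of $n+1$ points with all pairwise distances equal to a common positive number; its internal radius is the radius of the largest $n$-dimensional Euclidean ball it contains (its inscribed ball). A $k$-dimensional face of $T$ is the convex hull of some $k+1$ of its $n+1$ vertices. A $k$-dimensional Euclidean ball of radius $r>0$ in $\mathbb{R}^n$ is a set of the form $\{x\in\mathbb{R}^n:\sum_{j=1}^k\langle x-y,v_j\rangle^2\le r^2,\ \langle x-y,v_j\rangle=0\text{ for }k+1\le j\le n\}$, where $y\in\mathbb{R}^n$ and $(v_j)_{j=1}^n$ is an orthonormal basis of $\mathbb{R}^n$. *)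

theory Defs
  imports "HOL-Analysis.Analysis"
begin

text \<open>A regular solid simplex is \<open>convex hull V\<close> for such a vertex set \<open>V\<close>.\<close>

definition regular_simplex_vertices :: "'a::euclidean_space set \<Rightarrow> bool" where
  "regular_simplex_vertices V \<longleftrightarrow>
     finite V \<and> card V = DIM('a) + 1 \<and>
     (\<exists>d>0. \<forall>x\<in>V. \<forall>y\<in>V. x \<noteq> y \<longrightarrow> dist x y = d)"

definition simplex_face :: "'a::euclidean_space set \<Rightarrow> nat \<Rightarrow> 'a set \<Rightarrow> bool" where
  "simplex_face V k F \<longleftrightarrow> (\<exists>W\<subseteq>V. card W = k + 1 \<and> F = convex hull W)"

text \<open>Only the values \<open>v 1, \<dots>, v n\<close> with \<open>n = DIM('a)\<close> are relevant.\<close>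

definition orthonormal_basis :: "(nat \<Rightarrow> 'a::euclidean_space) \<Rightarrow> bool" where
  "orthonormal_basis v \<longleftrightarrow>
     (\<forall>i\<in>{1..DIM('a)}. \<forall>j\<in>{1..DIM('a)}. v i \<bullet> v j = (if i = j then 1 else 0)) \<and>
     span (v ` {1..DIM('a)}) = UNIV"

definition euclidean_ball :: "nat \<Rightarrow> real \<Rightarrow> 'a::euclidean_space set \<Rightarrow> bool" where
  "euclidean_ball k r B \<longleftrightarrow>
     r > 0 \<and>
     (\<exists>y v. orthonormal_basis v \<and>
        B = {x. (\<Sum>j=1..k. ((x - y) \<bullet> v j)\<^sup>2) \<le> r\<^sup>2 \<and>
                (\<forall>j\<in>{k+1..DIM('a)}. (x - y) \<bullet> v j = 0)})"

definition max_ball_radius :: "nat \<Rightarrow> 'a::euclidean_space set \<Rightarrow> real \<Rightarrow> bool" where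
  "max_ball_radius k T r \<longleftrightarrow>
     (\<exists>B. euclidean_ball k r B \<and> B \<subseteq> T) \<and>
     (\<forall>s B. euclidean_ball k s B \<and> B \<subseteq> T \<longrightarrow> s \<le> r)"

text \<open>The internal radius is the case \<open>k = n\<close>, where the balls are the usual solid balls
  (lemma \<open>euclidean_ball_full_iff\<close> below).\<close>

abbreviation has_internal_radius :: "'a::euclidean_space set \<Rightarrow> real \<Rightarrow> bool" where
  "has_internal_radius T r \<equiv> max_ball_radius DIM('a) T r"

lemma orthonormal_basis_exists: "\<exists>v :: nat \<Rightarrow> 'a::euclidean_space. orthonormal_basis v"
proof -
  obtain v :: "nat \<Rightarrow> 'a" where v: "bij_betw v {1..DIM('a)} Basis"
    using ex_bij_betw_nat_finite_1[OF finite_Basis] by blast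
  have "orthonormal_basis v"
    unfolding orthonormal_basis_def
  proof (intro conjI ballI)
    fix i j assume ij: "i \<in> {1..DIM('a)}" "j \<in> {1..DIM('a)}"
    then have "v i \<in> Basis" "v j \<in> Basis" "v i = v j \<longleftrightarrow> i = j"
      using v by (auto simp: bij_betw_def inj_on_eq_iff)
    then show "v i \<bullet> v j = (if i = j then 1 else 0)"
      by (simp add: inner_Basis)
  next
    show "span (v ` {1..DIM('a)}) = UNIV"
      using v by (simp add: bij_betw_def)
  qed
  then show ?thesis by blast
qed

lemma orthonormal_basis_norm:
  fixes v :: "nat \<Rightarrow> 'a::euclidean_space"
  assumes "orthonormal_basis v"
  shows "(\<Sum>j=1..DIM('a). (x \<bullet> v j)\<^sup>2) = (norm x)\<^sup>2"
proof -
  let ?I = "{1..DIM('a)}"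
  define z where "z = (\<Sum>j\<in>?I. (x \<bullet> v j) *\<^sub>R v j)"
  have o: "v i \<bullet> v j = (if i = j then 1 else 0)" if "i \<in> ?I" "j \<in> ?I" for i j
    using assms that by (auto simp: orthonormal_basis_def)
  have zi: "z \<bullet> v i = x \<bullet> v i" if i: "i \<in> ?I" for i
  proof -
    have "z \<bullet> v i = (\<Sum>j\<in>?I. (x \<bullet> v j) * (v j \<bullet> v i))"
      by (simp add: z_def inner_sum_left)
    also have "\<dots> = (\<Sum>j\<in>?I. if j = i then x \<bullet> v j else 0)"
      using o i by (intro sum.cong) auto
    finally show ?thesis using i by simp
  qed
  have "orthogonal (x - z) (x - z)"
  proof (rule orthogonal_to_span)
    show "x - z \<in> span (v ` ?I)"
      using assms by (simp add: orthonormal_basis_def)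
    show "\<And>w. w \<in> v ` ?I \<Longrightarrow> orthogonal (x - z) w"
      using zi by (auto simp: orthogonal_def inner_diff_left)
  qed
  then have xz: "x = z" by (simp add: orthogonal_self)
  have "x \<bullet> x = x \<bullet> z" using xz by simp
  also have "\<dots> = (\<Sum>j\<in>?I. (x \<bullet> v j)\<^sup>2)"
    by (simp add: z_def inner_sum_right power2_eq_square)
  finally show ?thesis by (simp add: power2_norm_eq_inner)
qed

lemma euclidean_ball_full_iff:
  fixes B :: "'a::euclidean_space set"
  shows "euclidean_ball DIM('a) r B \<longleftrightarrow> r > 0 \<and> (\<exists>y. B = cball y r)"
proof -
  have eq: "{x. (\<Sum>j=1..DIM('a). ((x - y) \<bullet> v j)\<^sup>2) \<le> r\<^sup>2 \<and>
            (\<forall>j\<in>{DIM('a)+1..DIM('a)}. (x - y) \<bullet> v j = 0)} = cball y r"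
    if v: "orthonormal_basis v" and r: "r > 0" for y :: 'a and v
  proof -
    have "(norm (x - y))\<^sup>2 \<le> r\<^sup>2 \<longleftrightarrow> norm (x - y) \<le> r" for x
      using r by (simp add: power2_le_iff_abs_le)
    then show ?thesis
      unfolding orthonormal_basis_norm[OF v] by (simp add: set_eq_iff dist_norm norm_minus_commute)
  qed
  show ?thesis
  proof
    assume "euclidean_ball DIM('a) r B"
    then obtain y v where "r > 0" "orthonormal_basis v"
      "B = {x. (\<Sum>j=1..DIM('a). ((x - y) \<bullet> v j)\<^sup>2) \<le> r\<^sup>2 \<and>
            (\<forall>j\<in>{DIM('a)+1..DIM('a)}. (x - y) \<bullet> v j = 0)}"
      unfolding euclidean_ball_def by blast
    with eq[of v y] show "r > 0 \<and> (\<exists>y. B = cball y r)" by blast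
  next
    assume "r > 0 \<and> (\<exists>y. B = cball y r)"
    then obtain y where y: "r > 0" "B = cball y r" by blast
    obtain v :: "nat \<Rightarrow> 'a" where v: "orthonormal_basis v"
      using orthonormal_basis_exists by blast
    show "euclidean_ball DIM('a) r B"
      unfolding euclidean_ball_def
      using y(1) v eq[OF v y(1), of y] y(2) by (intro conjI exI[of _ y] exI[of _ v]) auto
  qed
qed

end

theory Submission
  imports Defs
begin

text \<open>
  In barycentric coordinates, scaled so that the simplex has edge length \<open>\<surd>2\<close>, a \<open>k\<close>-ball with
  centre \<open>y\<close>, radius \<open>r\<close> and direction space \<open>H\<close> lies in the simplex iff \<open>r * sqrt (Q i i) \<le> y i\<close> for
  every \<open>i\<close>, where \<open>Q\<close> is the orthogonal projection onto \<open>H\<close>. Summing over \<open>i\<close> reduces the upper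
  bound to the inequality \<open>sqrt (k * (k + 1)) \<le> (\<Sum>i. sqrt (Q i i))\<close> for projections \<open>Q\<close> of rank \<open>k\<close>
  that annihilate the all-ones vector. If all \<open>Q i i\<close> are at most \<open>k / (k + 1)\<close>, compare each term
  linearly with \<open>Q i i\<close>, whose sum is \<open>k\<close>; equality forces \<open>k + 1\<close> diagonal entries to be \<open>k / (k + 1)\<close>
  and the others to vanish, so that the ball lies in a face. If some \<open>Q p p\<close> is larger, split off the
  direction of the projected \<open>p\<close>-th unit vector and use induction on \<open>k\<close> together with the triangle
  inequality in the plane; the inequality is then strict.
\<close>

section \<open>The diagonal of a projection matrix\<close>

text \<open>Triangle inequality for the complex numbers with real parts \<open>a i\<close> and
  imaginary parts \<open>b i\<close>.\<close>

lemma sqrt_sum_squares_le_sum_sqrt: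
  "sqrt ((\<Sum>i\<in>I. a i)\<^sup>2 + (\<Sum>i\<in>I. b i)\<^sup>2) \<le> (\<Sum>i\<in>I. sqrt ((a i)\<^sup>2 + (b i)\<^sup>2))"
  using norm_sum[of "\<lambda>i. Complex (a i) (b i)" I] by (simp add: cmod_def)

text \<open>By concavity the graph of the square root lies above its chord over the interval from 0
  to \<open>m\<^sup>2\<close>, whose slope is \<open>1 / m\<close>, and meets it only at the two
  endpoints.\<close>

lemma sum_sqrt_ge_sum_divide:
  fixes q :: "'i \<Rightarrow> real"
  assumes I: "finite I" and m: "m > 0" and q: "\<And>i. i \<in> I \<Longrightarrow> 0 \<le> q i \<and> q i \<le> m\<^sup>2"
  shows "sum q I / m \<le> (\<Sum>i\<in>I. sqrt (q i))"
    and "(\<Sum>i\<in>I. sqrt (q i)) = sum q I / m \<Longrightarrow> i \<in> I \<Longrightarrow> q i = 0 \<or> q i = m\<^sup>2"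
proof -
  have le: "q i / m \<le> sqrt (q i)" and eq: "q i / m = sqrt (q i) \<Longrightarrow> q i = 0 \<or> q i = m\<^sup>2"
    if "i \<in> I" for i
  proof -
    have s: "0 \<le> sqrt (q i)" "sqrt (q i) \<le> m" "q i = sqrt (q i) * sqrt (q i)"
      using q[OF that] m by (auto intro: real_le_lsqrt)
    then have "q i \<le> m * sqrt (q i)"
      by (metis mult_right_mono)
    then show "q i / m \<le> sqrt (q i)"
      using m by (simp add: field_simps)
    assume "q i / m = sqrt (q i)"
    then have "sqrt (q i) * sqrt (q i) = m * sqrt (q i)"
      using m s(3) by (simp add: field_simps)
    then have "sqrt (q i) = 0 \<or> sqrt (q i) = m"
      by (metis mult_right_cancel)
    then show "q i = 0 \<or> q i = m\<^sup>2"
      using s(3) by (metis power2_eq_square mult_zero_left)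
  qed
  show "sum q I / m \<le> (\<Sum>i\<in>I. sqrt (q i))"
    unfolding sum_divide_distrib by (intro sum_mono le)
  show "q i = 0 \<or> q i = m\<^sup>2" if sum: "(\<Sum>i\<in>I. sqrt (q i)) = sum q I / m" and i: "i \<in> I"
  proof (rule eq[OF i], rule ccontr)
    assume "q i / m \<noteq> sqrt (q i)"
    then have "q i / m < sqrt (q i)"
      using le[OF i] by simp
    then have "(\<Sum>i\<in>I. q i / m) < (\<Sum>i\<in>I. sqrt (q i))"
      using I i le by (intro sum_strict_mono_ex1) auto
    then show False
      using sum by (simp add: sum_divide_distrib)
  qed
qed

text \<open>The rank is expressed by the trace, so that removing a unit vector of the range from
  \<open>Q\<close> preserves all hypotheses and lowers \<open>k\<close> by one. Only the inequality
  of the induction hypothesis is used: the equality case is settled by the chord bound, or is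
  excluded by strictness.\<close>

lemma sum_sqrt_diag_projection:
  fixes Q :: "'i \<Rightarrow> 'i \<Rightarrow> real"
  assumes "finite I"
    and "\<And>i j. i \<in> I \<Longrightarrow> j \<in> I \<Longrightarrow> Q i j = Q j i"
    and "\<And>i l. i \<in> I \<Longrightarrow> l \<in> I \<Longrightarrow> (\<Sum>j\<in>I. Q i j * Q j l) = Q i l"
    and "\<And>i. i \<in> I \<Longrightarrow> (\<Sum>j\<in>I. Q i j) = 0"
    and "(\<Sum>i\<in>I. Q i i) = real k"
  shows "sqrt (real k * (real k + 1)) \<le> (\<Sum>i\<in>I. sqrt (Q i i)) \<and>
    ((\<Sum>i\<in>I. sqrt (Q i i)) = sqrt (real k * (real k + 1)) \<longrightarrow>
      (\<forall>i\<in>I. Q i i = 0 \<or> Q i i = real k / (real k + 1)))"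
  using assms
proof (induction k arbitrary: Q)
  case 0
  have sq: "Q i i = (\<Sum>j\<in>I. (Q i j)\<^sup>2)" if "i \<in> I" for i
    using 0(2) 0(3)[OF that that] that by (simp add: power2_eq_square cong: sum.cong)
  have nonneg: "0 \<le> Q i i" if "i \<in> I" for i
    unfolding sq[OF that] by (simp add: sum_nonneg)
  then have "\<forall>i\<in>I. Q i i = 0"
    using 0(1,5) by (simp add: sum_nonneg_eq_0_iff)
  then show ?case by simp
next
  case (Suc k)
  note fin = Suc(2) and sym = Suc(3) and idem = Suc(4) and rows = Suc(5) and trace = Suc(6)
  \<comment> \<open>The square of \<open>m\<close> is the value that the nonzero diagonal entries
    have in the extremal case; for this \<open>m\<close> the chord bound
    \<open>real (Suc k) / m\<close> is exactly the required root.\<close>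
  define m where "m = sqrt (real (Suc k) / (real (Suc k) + 1))"
  have m: "m > 0" "m\<^sup>2 = real (Suc k) / (real (Suc k) + 1)"
    by (auto simp: m_def)
  have mk: "real (Suc k) = m * m * (real (Suc k) + 1)"
    using m(2) by (simp add: power2_eq_square)
  have "real (Suc k) * (real (Suc k) + 1) = (m * (real (Suc k) + 1))\<^sup>2"
    using arg_cong[OF mk, of "\<lambda>x. x * (real (Suc k) + 1)"]
    by (simp only: power2_eq_square mult_ac)
  then have root': "sqrt (real (Suc k) * (real (Suc k) + 1)) = m * (real (Suc k) + 1)"
    using m(1) by simp
  also have "\<dots> = real (Suc k) / m"
    using arg_cong[OF mk, of "\<lambda>x. x / m"] m(1) by simp
  finally have root: "sqrt (real (Suc k) * (real (Suc k) + 1)) = real (Suc k) / m" .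
  have sq: "Q i i = (\<Sum>j\<in>I. (Q i j)\<^sup>2)" if "i \<in> I" for i
    using sym idem[OF that that] that by (simp add: power2_eq_square cong: sum.cong)
  have nonneg: "0 \<le> Q i i" if "i \<in> I" for i
    unfolding sq[OF that] by (simp add: sum_nonneg)
  show ?case
  proof (cases "\<forall>i\<in>I. Q i i \<le> m\<^sup>2")
    case True
    show ?thesis
      using sum_sqrt_ge_sum_divide[OF fin m(1), of "\<lambda>i. Q i i"] True nonneg
      unfolding trace root m(2)[symmetric] by blast
  next
    case False
    then obtain p where p: "p \<in> I" "m\<^sup>2 < Q p p" by force
    define s where "s = sqrt (Q p p)"
    have s2: "s\<^sup>2 = Q p p" and ms: "m < s"
      using p m nonneg[OF p(1)] by (auto simp: s_def intro: real_less_rsqrt)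
    then have s: "s > 0" "s \<noteq> 0" using m by auto
    txt \<open>Deflation: \<open>e\<close> is the projection of the \<open>p\<close>-th unit vector, normalised, and \<open>P\<close> projects onto
      its orthogonal complement in the range of \<open>Q\<close>.\<close>
    define e where "e i = Q i p / s" for i
    have ep: "e p = s" using s2 s by (simp add: e_def power2_eq_square flip: s2)
    define P where "P i j = Q i j - e i * e j" for i j
    have Qe: "(\<Sum>j\<in>I. Q i j * e j) = e i" if "i \<in> I" for i
      using idem[OF that p(1)] by (simp add: e_def flip: sum_divide_distrib)
    have ee: "(\<Sum>j\<in>I. e j * e j) = 1"
    proof -
      have "(\<Sum>j\<in>I. e j * e j) = (\<Sum>j\<in>I. Q p j * Q j p) / (s * s)"
        unfolding sum_divide_distrib by (intro sum.cong) (auto simp: e_def sym[OF p(1)])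
      then show ?thesis using idem[OF p(1) p(1)] s2 s by (simp add: power2_eq_square flip: s2)
    qed
    have esum: "(\<Sum>j\<in>I. e j) = 0"
      using rows[OF p(1)] sym[OF p(1)] by (simp add: e_def flip: sum_divide_distrib cong: sum.cong)
    have Psym: "P i j = P j i" if "i \<in> I" "j \<in> I" for i j
      using sym that by (simp add: P_def)
    have Pidem: "(\<Sum>j\<in>I. P i j * P j l) = P i l" if "i \<in> I" "l \<in> I" for i l
    proof -
      have "(\<Sum>j\<in>I. P i j * P j l) = (\<Sum>j\<in>I. Q i j * Q j l) - (\<Sum>j\<in>I. Q i j * e j) * e l
          - e i * (\<Sum>j\<in>I. Q l j * e j) + e i * e l * (\<Sum>j\<in>I. e j * e j)"
        unfolding sum_distrib_left sum_distrib_right sum_subtractf[symmetric] sum.distrib[symmetric]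
        using sym that by (intro sum.cong) (auto simp: P_def algebra_simps)
      then show ?thesis
        using idem Qe ee that by (simp add: P_def)
    qed
    have Prows: "(\<Sum>j\<in>I. P i j) = 0" if "i \<in> I" for i
      using rows[OF that] esum by (simp add: P_def sum_subtractf flip: sum_distrib_left)
    have Ptrace: "(\<Sum>i\<in>I. P i i) = real k"
      using trace ee by (simp add: P_def sum_subtractf)
    have IH: "sqrt (real k * (real k + 1)) \<le> (\<Sum>i\<in>I. sqrt (P i i))"
      using Suc.IH[of P, OF fin Psym Pidem Prows Ptrace] by blast
    have Pnonneg: "0 \<le> P i i" if "i \<in> I" for i
    proof -
      have "P i i = (\<Sum>j\<in>I. (P i j)\<^sup>2)"
        using Psym Pidem[OF that that] that by (simp add: power2_eq_square cong: sum.cong)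
      then show ?thesis by (simp add: sum_nonneg)
    qed
    let ?J = "I - {p}"
    have Ppp: "P p p = 0"
      using s2 by (simp add: P_def ep power2_eq_square)
    have PJ: "(\<Sum>i\<in>?J. sqrt (P i i)) = (\<Sum>i\<in>I. sqrt (P i i))"
      using sum.remove[OF fin p(1), of "\<lambda>i. sqrt (P i i)"] Ppp by simp
    \<comment> \<open>Here the vanishing row sums enter: they make the entries of \<open>e\<close>
      sum to zero, so those other than \<open>e p\<close> must balance \<open>s\<close>.\<close>
    have eJ: "(\<Sum>i\<in>?J. e i) = - s"
      using sum.remove[OF fin p(1), of e] esum ep by simp
    have k2: "real k * (real k + 1) \<le> (\<Sum>i\<in>?J. sqrt (P i i))\<^sup>2"
      unfolding PJ using IH by (simp add: sqrt_le_D)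
    \<comment> \<open>The term at \<open>p\<close> contributes \<open>s > m\<close>, so the
      remaining terms have to contribute \<open>m * real (Suc k)\<close>. Written as a hypotenuse,
      this is bounded by the legs \<open>s\<close> and the root from the induction
      hypothesis.\<close>
    have "m * real (Suc k) = sqrt (m\<^sup>2 + real k * (real k + 1))"
    proof -
      have "(m * real (Suc k))\<^sup>2 = m\<^sup>2 + real k * (real k + 1)"
        unfolding power_mult_distrib m(2)
        by (simp add: field_simps power2_eq_square)
      then show ?thesis using m(1) by (metis of_nat_0_le_iff less_imp_le mult_nonneg_nonneg real_sqrt_unique)
    qed
    also have "\<dots> \<le> sqrt ((\<Sum>i\<in>?J. e i)\<^sup>2 + (\<Sum>i\<in>?J. sqrt (P i i))\<^sup>2)"
      using k2 power_strict_mono[OF ms, of 2] m(1) unfolding eJ by simp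
    also have "\<dots> \<le> (\<Sum>i\<in>?J. sqrt ((e i)\<^sup>2 + (sqrt (P i i))\<^sup>2))"
      by (rule sqrt_sum_squares_le_sum_sqrt)
    also have "\<dots> = (\<Sum>i\<in>?J. sqrt (Q i i))"
      using Pnonneg by (intro sum.cong) (auto simp: P_def power2_eq_square)
    finally have "m * (real (Suc k) + 1) < (\<Sum>i\<in>I. sqrt (Q i i))"
      using ms sum.remove[OF fin p(1), of "\<lambda>i. sqrt (Q i i)"] by (simp add: s_def algebra_simps)
    then show ?thesis unfolding root' by linarith
  qed
qed

section \<open>Orthonormal bases\<close>

lemma orthonormal_basis_expansion:
  fixes v :: "nat \<Rightarrow> 'a::euclidean_space"
  assumes "orthonormal_basis v"
  shows "(\<Sum>j=1..DIM('a). (x \<bullet> v j) *\<^sub>R v j) = x"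
proof -
  let ?z = "\<Sum>j=1..DIM('a). (x \<bullet> v j) *\<^sub>R v j"
  have "(x - ?z) \<bullet> v i = 0" if "i \<in> {1..DIM('a)}" for i
  proof -
    have "?z \<bullet> v i = (\<Sum>j=1..DIM('a). if j = i then x \<bullet> v j else 0)"
      unfolding inner_sum_left using assms that
      by (intro sum.cong) (auto simp: orthonormal_basis_def)
    then show ?thesis using that by (simp add: inner_diff_left)
  qed
  then have "(norm (x - ?z))\<^sup>2 = 0"
    unfolding orthonormal_basis_norm[OF assms, symmetric] by simp
  then show ?thesis by simp
qed

text \<open>Orthonormal bases of \<open>H\<close> and of its orthogonal complement are joined, with
  that of \<open>H\<close> numbered first. Since \<open>euclidean_ball\<close> reads its directions
  off the first \<open>k\<close> vectors of a full basis, this is what allows a ball to be placed in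
  a given face.\<close>

lemma orthonormal_basis_adapted:
  fixes H :: "'a::euclidean_space set"
  assumes H: "subspace H" "dim H = k"
  obtains v where "orthonormal_basis v" "v ` {1..k} \<subseteq> H"
proof -
  let ?C = "{y. \<forall>x\<in>H. orthogonal x y}"
  obtain A where A: "A \<subseteq> H" "pairwise orthogonal A" "\<And>x. x \<in> A \<Longrightarrow> norm x = 1"
      "independent A" "card A = dim H" "span A = H"
    by (blast intro: orthonormal_basis_subspace[OF H(1)])
  obtain B where B: "B \<subseteq> ?C" "pairwise orthogonal B" "\<And>x. x \<in> B \<Longrightarrow> norm x = 1"
      "independent B" "card B = dim ?C" "span B = ?C"
    by (blast intro: orthonormal_basis_subspace[OF subspace_orthogonal_to_vectors[of H]])
  have cross: "x \<bullet> y = 0" if "x \<in> A" "y \<in> B" for x y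
    using that A(1) B(1) unfolding orthogonal_def by blast
  have unit: "x \<bullet> x = 1" if "x \<in> A \<union> B" for x
    using that A(3) B(3) norm_eq_1 by blast
  have AB: "x \<bullet> y = 0" if "x \<in> A \<union> B" "y \<in> A \<union> B" "x \<noteq> y" for x y
    using that cross[of x y] cross[of y x] A(2) B(2)
    by (auto simp: pairwise_def orthogonal_def inner_commute)
  have fin: "finite A" "finite B"
    using A(4) B(4) independent_imp_finite by auto
  have disj: "A \<inter> B = {}"
  proof (rule ccontr)
    assume "A \<inter> B \<noteq> {}"
    then obtain x where "x \<in> A" "x \<in> B" by blast
    then show False using cross[of x x] unit[of x] by simp
  qed
  have dims: "dim ?C + dim H = DIM('a)"
    using dim_subspace_orthogonal_to_vectors[OF H(1) subspace_UNIV] by simp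
  have card: "card A = k" "card B = DIM('a) - k" "k \<le> DIM('a)"
    using A(5) B(5) H(2) dims by auto
  obtain f where f: "bij_betw f {1..k} A"
    using ex_bij_betw_nat_finite_1[OF fin(1)] card by auto
  obtain g where g: "bij_betw g {k+1..DIM('a)} B"
    using finite_same_card_bij[of "{k+1..DIM('a)}" B] fin card by auto
  define v where "v i = (if i \<in> {1..k} then f i else g i)" for i
  have "bij_betw v {1..k} A"
    using f by (rule bij_betw_cong[THEN iffD1, rotated]) (simp add: v_def)
  moreover have "bij_betw v {k+1..DIM('a)} B"
    using g by (rule bij_betw_cong[THEN iffD1, rotated]) (simp add: v_def)
  ultimately have "bij_betw v ({1..k} \<union> {k+1..DIM('a)}) (A \<union> B)"
    using disj by (rule bij_betw_combine)
  moreover have un: "{1..k} \<union> {k+1..DIM('a)} = {1..DIM('a)}"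
    using card by auto
  ultimately have v: "bij_betw v {1..DIM('a)} (A \<union> B)" by simp
  have "pairwise orthogonal (A \<union> B)" "0 \<notin> A \<union> B"
    using AB unit[of 0] by (auto simp: pairwise_def orthogonal_def)
  then have "independent (A \<union> B)"
    by (rule pairwise_orthogonal_independent)
  moreover have "card (A \<union> B) = DIM('a)"
    using card fin disj by (simp add: card_Un_disjoint)
  ultimately have "span (A \<union> B) = UNIV"
    using dim_eq_full[of "A \<union> B"] dim_eq_card_independent[of "A \<union> B"] by simp
  moreover have "v i \<bullet> v j = (if i = j then 1 else 0)" if "i \<in> {1..DIM('a)}" "j \<in> {1..DIM('a)}" for i j
  proof -
    have "v i \<in> A \<union> B" "v j \<in> A \<union> B" "v i = v j \<longleftrightarrow> i = j"
      using v that by (auto simp: bij_betw_def inj_on_eq_iff)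
    then show ?thesis using AB[of "v i" "v j"] unit[of "v i"] by auto
  qed
  moreover have "v ` {1..DIM('a)} = A \<union> B"
    using v by (rule bij_betw_imp_surj_on)
  ultimately have "orthonormal_basis v"
    unfolding orthonormal_basis_def by simp
  moreover have "v ` {1..k} \<subseteq> H"
    using bij_betw_imp_surj_on[OF f] A(1) by (auto simp: v_def)
  ultimately show thesis by (rule that)
qed

section \<open>Barycentric coordinates and the frame of a regular simplex\<close>

locale regular_simplex =
  fixes V :: "'a::euclidean_space set" and d :: real
  assumes fin: "finite V" and card_V: "card V = DIM('a) + 1"
    and d_pos: "d > 0" and dist_V: "\<And>x y. x \<in> V \<Longrightarrow> y \<in> V \<Longrightarrow> x \<noteq> y \<Longrightarrow> dist x y = d"
begin

definition centroid :: 'a where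
  "centroid = (1 / real (card V)) *\<^sub>R \<Sum>V"

definition scale :: real where
  "scale = sqrt 2 / d"

text \<open>The scaling makes the vectors below a Parseval frame: their Gram matrix is the projection
  onto the orthogonal complement of the all-ones vector.\<close>

definition frame_vec :: "'a \<Rightarrow> 'a" where
  "frame_vec v = scale *\<^sub>R (v - centroid)"

text \<open>The barycentric coordinate belonging to the vertex \<open>v\<close>, given as an affine
  function with gradient \<open>scale *\<^sub>R frame_vec v\<close> and value
  \<open>1 / real (card V)\<close> at the centroid. The explicit gradient is what the estimates on
  balls use.\<close>

definition bary :: "'a \<Rightarrow> 'a \<Rightarrow> real" where
  "bary v x = 1 / real (card V) + scale * (frame_vec v \<bullet> (x - centroid))"

lemma scale_pos: "scale > 0"
  using d_pos by (simp add: scale_def)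

lemma card_V_pos: "real (card V) > 0"
  using card_V by simp

text \<open>Polarisation of the common distance; it leaves the squared norms of the vertices as the
  only unknowns, wherever the origin lies.\<close>

lemma inner_vertices:
  assumes "v \<in> V" "w \<in> V"
  shows "v \<bullet> w = (v \<bullet> v + w \<bullet> w) / 2 - d\<^sup>2 / 2 + (if v = w then d\<^sup>2 / 2 else 0)"
proof (cases "v = w")
  case False
  then have "(norm (v - w))\<^sup>2 = d\<^sup>2"
    using dist_V[OF assms] by (simp add: dist_norm)
  then show ?thesis
    using False by (simp add: power2_norm_eq_inner inner_diff_left inner_diff_right inner_commute field_simps)
qed simp

lemma inner_frame_vec:
  assumes "v \<in> V" "w \<in> V"
  shows "frame_vec v \<bullet> frame_vec w = (if v = w then 1 else 0) - 1 / real (card V)"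
proof -
  define N where "N = real (card V)"
  have N: "N > 0" using card_V_pos by (simp add: N_def)
  \<comment> \<open>The mean squared norm of the vertices. It depends on the position of the origin,
    as \<open>v \<bullet> v\<close> and \<open>w \<bullet> w\<close> do, and all three cancel once
    the centroid is subtracted.\<close>
  define m where "m = (\<Sum>x\<in>V. x \<bullet> x) / N"
  have sum: "(\<Sum>x\<in>V. x \<bullet> x) = N * m"
    using N by (simp add: m_def)
  have vg: "v \<bullet> centroid = (v \<bullet> v + m) / 2 - d\<^sup>2 / 2 + d\<^sup>2 / (2 * N)" if "v \<in> V" for v
  proof -
    have "v \<bullet> \<Sum>V = (\<Sum>x\<in>V. (v \<bullet> v + x \<bullet> x) / 2 - d\<^sup>2 / 2 + (if v = x then d\<^sup>2 / 2 else 0))"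
      unfolding inner_sum_right using that by (intro sum.cong inner_vertices) auto
    also have "\<dots> = N * (v \<bullet> v + m) / 2 - N * d\<^sup>2 / 2 + d\<^sup>2 / 2"
      using fin that sum
      by (simp add: sum.distrib sum_subtractf N_def distrib_left flip: sum_divide_distrib)
    finally show ?thesis
      using N by (simp add: centroid_def field_simps flip: N_def)
  qed
  have "centroid \<bullet> centroid = (\<Sum>v\<in>V. v \<bullet> centroid) / N"
    unfolding inner_sum_left[symmetric] by (subst (1) centroid_def) (simp add: N_def)
  also have "\<dots> = (\<Sum>v\<in>V. (v \<bullet> v + m) / 2 - d\<^sup>2 / 2 + d\<^sup>2 / (2 * N)) / N"
    using vg by simp
  also have "(\<Sum>v\<in>V. (v \<bullet> v + m) / 2 - d\<^sup>2 / 2 + d\<^sup>2 / (2 * N)) =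
      (\<Sum>v\<in>V. v \<bullet> v) / 2 + N * (m / 2 - d\<^sup>2 / 2 + d\<^sup>2 / (2 * N))"
    by (simp add: add_divide_distrib sum.distrib sum_subtractf sum_divide_distrib
        right_diff_distrib distrib_left flip: N_def)
  also have "\<dots> / N = m - d\<^sup>2 / 2 + d\<^sup>2 / (2 * N)"
    using N sum by (simp add: field_simps)
  finally have gg: "centroid \<bullet> centroid = m - d\<^sup>2 / 2 + d\<^sup>2 / (2 * N)" .
  have "(v - centroid) \<bullet> (w - centroid) = v \<bullet> w - v \<bullet> centroid - w \<bullet> centroid + centroid \<bullet> centroid"
    by (simp add: inner_diff_left inner_diff_right inner_commute)
  also have "\<dots> = d\<^sup>2 / 2 * ((if v = w then 1 else 0) - 1 / N)"
    unfolding vg[OF assms(1)] vg[OF assms(2)] gg inner_vertices[OF assms]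
    by (simp add: field_simps)
  finally have "(v - centroid) \<bullet> (w - centroid) = d\<^sup>2 / 2 * ((if v = w then 1 else 0) - 1 / N)" .
  moreover have "frame_vec v \<bullet> frame_vec w = scale\<^sup>2 * ((v - centroid) \<bullet> (w - centroid))"
    by (simp add: frame_vec_def power2_eq_square)
  moreover have "scale\<^sup>2 * (d\<^sup>2 / 2) = 1"
    using d_pos by (simp add: scale_def power_divide)
  ultimately show ?thesis
    by (metis N_def mult.assoc mult_1)
qed

lemma sum_frame_vec: "(\<Sum>v\<in>V. frame_vec v) = 0"
  using card_V_pos by (simp add: frame_vec_def centroid_def sum_subtractf sum_constant_scaleR flip: scaleR_sum_right)

lemma frame_vec_diff: "frame_vec v - frame_vec w = scale *\<^sub>R (v - w)"
  by (simp add: frame_vec_def scaleR_diff_right)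

lemma bary_vertex:
  assumes "v \<in> V" "w \<in> V"
  shows "bary v w = (if v = w then 1 else 0)"
  using inner_frame_vec[OF assms] by (simp add: bary_def frame_vec_def)

lemma bary_affine_sum:
  assumes "finite W" "sum u W = 1"
  shows "bary v (\<Sum>w\<in>W. u w *\<^sub>R w) = (\<Sum>w\<in>W. u w * bary v w)"
proof -
  have "(\<Sum>w\<in>W. u w * bary v w) =
      sum u W * (1 / real (card V)) + scale * (\<Sum>w\<in>W. u w * (frame_vec v \<bullet> w))
      - sum u W * (scale * (frame_vec v \<bullet> centroid))"
    unfolding sum_distrib_left sum_distrib_right sum.distrib[symmetric] sum_subtractf[symmetric]
    by (intro sum.cong) (auto simp: bary_def inner_diff_right algebra_simps)
  then show ?thesis
    by (simp add: assms(2) bary_def inner_diff_right inner_sum_right algebra_simps)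
qed

lemma bary_add: "bary v (x + u) = bary v x + scale * (frame_vec v \<bullet> u)"
  by (simp add: bary_def inner_diff_right inner_add_right algebra_simps)

text \<open>An affine dependence passes to the frame vectors because its coefficients sum to zero.
  On such coefficients the Gram matrix acts as the identity, so the inner product with
  \<open>frame_vec w\<close> isolates \<open>U w\<close>.\<close>

lemma affine_independent_V: "\<not> affine_dependent V"
proof
  assume "affine_dependent V"
  then obtain U w where U: "sum U V = 0" "w \<in> V" "U w \<noteq> 0" "(\<Sum>v\<in>V. U v *\<^sub>R v) = 0"
    using affine_dependent_explicit_finite[OF fin] by blast
  have "(\<Sum>v\<in>V. U v *\<^sub>R frame_vec v) = scale *\<^sub>R ((\<Sum>v\<in>V. U v *\<^sub>R v) - sum U V *\<^sub>R centroid)"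
    by (simp add: frame_vec_def scaleR_diff_right sum_subtractf scaleR_sum_right scaleR_sum_left
        sum_distrib_left mult.commute)
  then have "0 = frame_vec w \<bullet> (\<Sum>v\<in>V. U v *\<^sub>R frame_vec v)"
    using U by simp
  also have "\<dots> = (\<Sum>v\<in>V. U v * (if w = v then 1 else 0) - U v / real (card V))"
    unfolding inner_sum_right using U(2) by (intro sum.cong) (auto simp: inner_frame_vec algebra_simps)
  also have "\<dots> = U w"
    using U fin
    by (simp add: sum_subtractf if_distrib[of "(*) _"] cong: if_cong flip: sum_divide_distrib)
  finally show False using U by simp
qed

text \<open>The affine hull of \<open>DIM('a) + 1\<close> affinely independent points is the whole
  space, so \<open>x\<close> is an affine combination of vertices, and \<open>bary\<close> reads off
  its coefficients.\<close>

lemma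
  shows sum_bary: "(\<Sum>v\<in>V. bary v x) = 1"
    and bary_expansion: "(\<Sum>v\<in>V. bary v x *\<^sub>R v) = x"
proof -
  have "x \<in> affine hull V"
    using affine_independent_span_eq[OF affine_independent_V] card_V by simp
  then obtain u where u: "sum u V = 1" "(\<Sum>v\<in>V. u v *\<^sub>R v) = x"
    unfolding affine_hull_finite[OF fin] by blast
  have "bary v x = u v" if "v \<in> V" for v
    using bary_affine_sum[OF fin u(1), of v] u(2) that fin
    by (simp add: bary_vertex if_distrib[of "(*) _"] cong: if_cong)
  then show "(\<Sum>v\<in>V. bary v x) = 1" "(\<Sum>v\<in>V. bary v x *\<^sub>R v) = x"
    using u by simp_all
qed

text \<open>This is the linear part of \<open>bary_expansion\<close> at \<open>centroid + u\<close>;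
  replacing \<open>v\<close> by \<open>v - centroid\<close> costs only a multiple of the sum of the
  frame vectors, which is zero.\<close>

lemma sum_inner_frame_vec: "(\<Sum>v\<in>V. (frame_vec v \<bullet> u) *\<^sub>R frame_vec v) = u"
proof -
  have "centroid + u = (\<Sum>v\<in>V. bary v (centroid + u) *\<^sub>R v)"
    by (simp add: bary_expansion)
  also have "\<dots> = centroid + (\<Sum>v\<in>V. (scale * (frame_vec v \<bullet> u)) *\<^sub>R v)"
    by (simp add: bary_def scaleR_add_left sum.distrib centroid_def flip: scaleR_sum_right)
  also have "(\<Sum>v\<in>V. (scale * (frame_vec v \<bullet> u)) *\<^sub>R v) =
      (\<Sum>v\<in>V. (frame_vec v \<bullet> u) *\<^sub>R frame_vec v) + (scale * ((\<Sum>v\<in>V. frame_vec v) \<bullet> u)) *\<^sub>R centroid"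
    unfolding inner_sum_left sum_distrib_left scaleR_sum_left sum.distrib[symmetric]
    by (intro sum.cong) (auto simp: frame_vec_def scaleR_diff_right algebra_simps)
  finally show ?thesis by (simp add: sum_frame_vec)
qed

lemma frame_vec_parseval: "(\<Sum>v\<in>V. (frame_vec v \<bullet> u) * (frame_vec v \<bullet> w)) = u \<bullet> w"
proof -
  have "u \<bullet> w = (\<Sum>v\<in>V. (frame_vec v \<bullet> u) *\<^sub>R frame_vec v) \<bullet> w" by (simp add: sum_inner_frame_vec)
  then show ?thesis by (simp add: inner_sum_left)
qed

lemma mem_face_iff:
  assumes "W \<subseteq> V"
  shows "x \<in> convex hull W \<longleftrightarrow> (\<forall>v\<in>V. 0 \<le> bary v x) \<and> (\<forall>v\<in>V - W. bary v x = 0)"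
proof -
  have finW: "finite W" using assms fin finite_subset by blast
  show ?thesis
  proof
    assume "x \<in> convex hull W"
    then obtain u where u: "\<forall>w\<in>W. 0 \<le> u w" "sum u W = 1" "(\<Sum>w\<in>W. u w *\<^sub>R w) = x"
      unfolding convex_hull_finite[OF finW] by blast
    have "bary v x = (if v \<in> W then u v else 0)" if "v \<in> V" for v
    proof -
      have "bary v x = (\<Sum>w\<in>W. u w * bary v w)"
        using bary_affine_sum[OF finW u(2)] u(3) by simp
      also have "\<dots> = (\<Sum>w\<in>W. if v = w then u w else 0)"
        using assms that by (intro sum.cong) (auto simp: bary_vertex)
      finally show ?thesis using finW by simp
    qed
    then show "(\<forall>v\<in>V. 0 \<le> bary v x) \<and> (\<forall>v\<in>V - W. bary v x = 0)"
      using u(1) by simp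
  next
    assume x: "(\<forall>v\<in>V. 0 \<le> bary v x) \<and> (\<forall>v\<in>V - W. bary v x = 0)"
    have "(\<Sum>v\<in>W. bary v x) = (\<Sum>v\<in>V. bary v x)"
        "(\<Sum>v\<in>W. bary v x *\<^sub>R v) = (\<Sum>v\<in>V. bary v x *\<^sub>R v)"
      using x by (intro sum.mono_neutral_left fin assms; simp)+
    then have "sum (\<lambda>v. bary v x) W = 1 \<and> (\<Sum>v\<in>W. bary v x *\<^sub>R v) = x"
      unfolding sum_bary bary_expansion by (rule conjI)
    moreover have "\<forall>v\<in>W. 0 \<le> bary v x"
      using x assms by auto
    ultimately show "x \<in> convex hull W"
      unfolding convex_hull_finite[OF finW] mem_Collect_eq by (intro exI[of _ "\<lambda>v. bary v x"] conjI) simp_all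
  qed
qed

lemma mem_simplex_iff: "x \<in> convex hull V \<longleftrightarrow> (\<forall>v\<in>V. 0 \<le> bary v x)"
  using mem_face_iff[of V] by simp

section \<open>Balls in the simplex: the upper bound and its equality case\<close>

text \<open>In the chain \<open>scale * r * sqrt (real k * (real k + 1)) \<le> scale * r *
  (\<Sum>i\<in>V. sqrt (Q i i)) \<le> (\<Sum>i\<in>V. bary i y) = 1\<close> the outer terms give the
  bound; if they agree, every inequality used is tight, which locates the face.\<close>

lemma
  assumes ball: "euclidean_ball k r B" and sub: "B \<subseteq> convex hull V" and k: "k \<le> DIM('a)"
  shows ball_radius_le: "scale * r * sqrt (real k * (real k + 1)) \<le> 1"
    and ball_in_face: "0 < k \<Longrightarrow> scale * r * sqrt (real k * (real k + 1)) = 1 \<Longrightarrow>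
      \<exists>W\<subseteq>V. card W = k + 1 \<and> B \<subseteq> convex hull W"
proof -
  obtain y v where r: "r > 0" and v: "orthonormal_basis v"
    and B: "B = {x. (\<Sum>j=1..k. ((x - y) \<bullet> v j)\<^sup>2) \<le> r\<^sup>2 \<and>
                (\<forall>j\<in>{k+1..DIM('a)}. (x - y) \<bullet> v j = 0)}"
    using ball unfolding euclidean_ball_def by blast
  have on: "v l \<bullet> v m = (if l = m then 1 else 0)" if "l \<in> {1..DIM('a)}" "m \<in> {1..DIM('a)}" for l m
    using v that by (auto simp: orthonormal_basis_def)
  \<comment> \<open>The projection onto the direction space of the ball, carried over by the map
    sending \<open>u\<close> to the numbers \<open>frame_vec i \<bullet> u\<close>. Parseval makes
    this map isometric, whence idempotence and trace; the row sums vanish because the frame vectors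
    sum to zero.\<close>
  define Q where "Q i j = (\<Sum>l=1..k. (frame_vec i \<bullet> v l) * (frame_vec j \<bullet> v l))" for i j
  have Qsym: "Q i j = Q j i" for i j
    by (simp add: Q_def mult.commute)
  have Qidem: "(\<Sum>j\<in>V. Q i j * Q j m) = Q i m" for i m
  proof -
    have "(\<Sum>j\<in>V. Q i j * Q j m) =
        (\<Sum>j\<in>V. \<Sum>l=1..k. \<Sum>p=1..k. (frame_vec i \<bullet> v l) * (frame_vec m \<bullet> v p) *
          ((frame_vec j \<bullet> v l) * (frame_vec j \<bullet> v p)))"
      unfolding Q_def sum_product by (intro sum.cong refl) (simp add: mult_ac)
    also have "\<dots> =
        (\<Sum>l=1..k. \<Sum>p=1..k. (frame_vec i \<bullet> v l) * (frame_vec m \<bullet> v p) *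
          (\<Sum>j\<in>V. (frame_vec j \<bullet> v l) * (frame_vec j \<bullet> v p)))"
      unfolding sum_distrib_left
      by (subst sum.swap, intro sum.cong refl, subst sum.swap, rule refl)
    also have "\<dots> = (\<Sum>l=1..k. \<Sum>p=1..k. if p = l then (frame_vec i \<bullet> v l) * (frame_vec m \<bullet> v p) else 0)"
      unfolding frame_vec_parseval using on k by (intro sum.cong refl) auto
    also have "\<dots> = Q i m" by (simp add: Q_def)
    finally show ?thesis .
  qed
  have Qrows: "(\<Sum>j\<in>V. Q i j) = 0" for i
    unfolding Q_def
    by (subst sum.swap) (simp add: sum_frame_vec flip: sum_distrib_left inner_sum_left)
  have Qtrace: "(\<Sum>i\<in>V. Q i i) = real k"
  proof -
    have "(\<Sum>i\<in>V. Q i i) = (\<Sum>l=1..k. v l \<bullet> v l)"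
      unfolding Q_def by (subst sum.swap) (simp add: frame_vec_parseval)
    also have "\<dots> = (\<Sum>l=1..k. 1)"
      using on k by (intro sum.cong) auto
    finally show ?thesis by simp
  qed
  note key = sum_sqrt_diag_projection[of V Q k, OF fin Qsym Qidem Qrows Qtrace]
  have Qdiag: "Q i i = (\<Sum>l=1..k. (frame_vec i \<bullet> v l)\<^sup>2)" for i
    by (simp add: Q_def power2_eq_square)
  then have Qnonneg: "0 \<le> Q i i" for i
    by (simp add: sum_nonneg)
  txt \<open>Evaluate the barycentric coordinate \<open>i\<close> at the point of the ball where it is smallest.\<close>
  have support: "scale * r * sqrt (Q i i) \<le> bary i y" if i: "i \<in> V" for i
  proof (cases "Q i i = 0")
    case True
    have "y \<in> B" by (simp add: B)
    then show ?thesis using True sub i mem_simplex_iff by auto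
  next
    case False
    define s where "s = sqrt (Q i i)"
    have s: "s > 0" "s\<^sup>2 = Q i i"
      using False Qnonneg[of i] by (auto simp: s_def)
    \<comment> \<open>The sum is the projection of \<open>frame_vec i\<close> onto the direction
      space and has norm \<open>s\<close>; \<open>u\<close> is its reversal rescaled to length
      \<open>r\<close>.\<close>
    define u where "u = - (r / s) *\<^sub>R (\<Sum>l=1..k. (frame_vec i \<bullet> v l) *\<^sub>R v l)"
    have uv: "u \<bullet> v j = (if j \<in> {1..k} then - (r / s) * (frame_vec i \<bullet> v j) else 0)" if "j \<in> {1..DIM('a)}" for j
    proof -
      have "(\<Sum>l=1..k. (frame_vec i \<bullet> v l) *\<^sub>R v l) \<bullet> v j = (\<Sum>l=1..k. if l = j then frame_vec i \<bullet> v l else 0)"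
        unfolding inner_sum_left using on that k by (intro sum.cong) auto
      then show ?thesis by (simp add: u_def)
    qed
    have "(\<Sum>j=1..k. (u \<bullet> v j)\<^sup>2) = (\<Sum>j=1..k. (r / s)\<^sup>2 * (frame_vec i \<bullet> v j)\<^sup>2)"
      using uv k by (intro sum.cong) (auto simp: power_mult_distrib power_divide)
    also have "\<dots> = (r / s)\<^sup>2 * Q i i"
      by (simp only: Qdiag sum_distrib_left)
    also have "\<dots> = r\<^sup>2"
      using s False by (simp add: power_divide)
    finally have "y + u \<in> B"
      using uv by (simp add: B)
    then have "0 \<le> bary i (y + u)"
      using sub i mem_simplex_iff by auto
    also have "frame_vec i \<bullet> u = - (r / s) * Q i i"
      by (simp add: u_def Qdiag inner_sum_right power2_eq_square)
    then have "bary i (y + u) = bary i y - scale * r * s"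
      using s(1) by (simp add: bary_add power2_eq_square flip: s(2))
    finally show ?thesis by (simp add: s_def)
  qed
  have sum_le: "scale * r * (\<Sum>i\<in>V. sqrt (Q i i)) \<le> 1"
    unfolding sum_distrib_left sum_bary[of y, symmetric] by (intro sum_mono support)
  have le: "scale * r * sqrt (real k * (real k + 1)) \<le> scale * r * (\<Sum>i\<in>V. sqrt (Q i i))"
    using key r scale_pos by (intro mult_left_mono) auto
  with sum_le show "scale * r * sqrt (real k * (real k + 1)) \<le> 1"
    by linarith
  assume k0: "0 < k" and eq: "scale * r * sqrt (real k * (real k + 1)) = 1"
  then have sum_eq: "scale * r * (\<Sum>i\<in>V. sqrt (Q i i)) = 1"
    using le sum_le by linarith
  then have "scale * r * (\<Sum>i\<in>V. sqrt (Q i i)) = scale * r * sqrt (real k * (real k + 1))"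
    using eq by simp
  then have "(\<Sum>i\<in>V. sqrt (Q i i)) = sqrt (real k * (real k + 1))"
    using r scale_pos by simp
  then have Q01: "Q i i = 0 \<or> Q i i = real k / (real k + 1)" if "i \<in> V" for i
    using key that by blast
  define W where "W = {i \<in> V. Q i i \<noteq> 0}"
  have W: "W \<subseteq> V" "finite W" using fin by (auto simp: W_def)
  \<comment> \<open>The trace \<open>k\<close> is made up of equal entries
    \<open>k / (k + 1)\<close>, so there are \<open>k + 1\<close> of them; \<open>0 < k\<close>
    permits the cancellation.\<close>
  have "real k = (\<Sum>i\<in>W. Q i i)"
    unfolding Qtrace[symmetric] using fin by (intro sum.mono_neutral_right) (auto simp: W_def)
  also have "\<dots> = (\<Sum>i\<in>W. real k / (real k + 1))"
    using Q01 by (intro sum.cong) (auto simp: W_def)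
  finally have "real k * real (card W) = real k * (real k + 1)"
    by (simp add: field_simps)
  then have "real (card W) = real k + 1"
    using k0 by simp
  then have card_W: "card W = k + 1" by linarith
  have "(\<Sum>i\<in>V. bary i y - scale * r * sqrt (Q i i)) = 0"
    using sum_eq by (simp add: sum_subtractf sum_bary flip: sum_distrib_left)
  then have y_eq: "bary i y = scale * r * sqrt (Q i i)" if "i \<in> V" for i
    using sum_nonneg_eq_0_iff[OF fin, of "\<lambda>i. bary i y - scale * r * sqrt (Q i i)"] support that
    by simp
  have "x \<in> convex hull W" if x: "x \<in> B" for x
    unfolding mem_face_iff[OF W(1)]
  proof (intro conjI ballI)
    show "0 \<le> bary i x" if "i \<in> V" for i
      using x sub that mem_simplex_iff by blast
    \<comment> \<open>A vanishing \<open>Q i i\<close> makes \<open>frame_vec i\<close> orthogonal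
      to all directions of the ball. Hence \<open>bary i\<close> is constant on the ball, and its
      value at the centre is zero by tightness.\<close>
    fix i assume i: "i \<in> V - W"
    then have Q0: "Q i i = 0" by (simp add: W_def)
    then have bv: "frame_vec i \<bullet> v l = 0" if "l \<in> {1..k}" for l
      using that unfolding Qdiag by (subst (asm) sum_nonneg_eq_0_iff) auto
    have "frame_vec i \<bullet> (x - y) = (\<Sum>j=1..DIM('a). ((x - y) \<bullet> v j) * (frame_vec i \<bullet> v j))"
      using arg_cong[OF orthonormal_basis_expansion[OF v, of "x - y"], of "\<lambda>z. frame_vec i \<bullet> z"]
      by (simp add: inner_sum_right)
    also have "\<dots> = 0"
      using x bv by (intro sum.neutral) (auto simp: B)
    finally show "bary i x = 0"
      using bary_add[of i y "x - y"] y_eq[of i] i Q0 by simp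
  qed
  then show "\<exists>W\<subseteq>V. card W = k + 1 \<and> B \<subseteq> convex hull W"
    using W card_W by blast
qed

section \<open>Balls attaining the bound\<close>

text \<open>The ball is centred at the centroid of the face, where each coordinate of
  \<open>W\<close> is \<open>1 / (k + 1)\<close>. Along the face such a coordinate has slope
  \<open>scale * sqrt (k / (k + 1))\<close>, and \<open>r\<close> is the distance over which it can
  fall to zero.\<close>

lemma face_contains_ball:
  assumes W: "W \<subseteq> V" "card W = k + 1" and k: "0 < k"
    and r: "r = 1 / (scale * sqrt (real k * (real k + 1)))"
  shows "\<exists>B. euclidean_ball k r B \<and> B \<subseteq> convex hull W"
proof -
  define K where "K = real k + 1"
  have K: "K > 0" "real (card W) = K" by (auto simp: K_def W)
  have finW: "finite W" using W(1) fin finite_subset by blast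
  obtain w0 where w0: "w0 \<in> W" using W(2) by force
  define H where "H = span ((\<lambda>x. x - w0) ` W)"
  have "\<not> affine_dependent W"
    using affine_independent_V W(1) by (rule affine_independent_subset)
  then have "dim H = k"
    using affine_independent_card_dim_diffs[of W w0] w0 W(2) by (simp add: H_def)
  then obtain v where v: "orthonormal_basis v" "v ` {1..k} \<subseteq> H"
    using orthonormal_basis_adapted[of H k] by (auto simp: H_def)
  define y where "y = (\<Sum>w\<in>W. (1 / K) *\<^sub>R w)"
  have y: "bary i y = (if i \<in> W then 1 / K else 0)" if "i \<in> V" for i
  proof -
    have "bary i y = (\<Sum>w\<in>W. 1 / K * bary i w)"
      unfolding y_def using K by (intro bary_affine_sum finW) simp
    also have "\<dots> = (\<Sum>w\<in>W. if i = w then 1 / K else 0)"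
      using W(1) that by (intro sum.cong) (auto simp: bary_vertex)
    finally show ?thesis using finW by simp
  qed
  \<comment> \<open>Differences of vertices span \<open>H\<close>, so equal inner products with all
    the \<open>frame_vec w\<close> suffice. This serves both the vertices outside \<open>W\<close>
    and the vector \<open>m\<close>.\<close>
  have orthH: "a \<bullet> u = 0" if "u \<in> H" "\<And>w. w \<in> W \<Longrightarrow> a \<bullet> frame_vec w = c" for a u c
  proof -
    have "orthogonal a u"
    proof (rule orthogonal_to_span)
      show "u \<in> span ((\<lambda>x. x - w0) ` W)" using that(1) by (simp add: H_def)
      fix z assume "z \<in> (\<lambda>x. x - w0) ` W"
      then obtain w where w: "w \<in> W" "z = w - w0" by blast
      have "scale * (a \<bullet> z) = a \<bullet> frame_vec w - a \<bullet> frame_vec w0"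
        unfolding inner_diff_right[symmetric] frame_vec_diff w(2) by simp
      then show "orthogonal a z"
        using that(2)[OF w(1)] that(2)[OF w0] scale_pos by (simp add: orthogonal_def)
    qed
    then show ?thesis by (simp add: orthogonal_def)
  qed
  \<comment> \<open>Up to scaling, the vector from the centroid of the simplex to that of the face.
    It is normal to \<open>H\<close>, so subtracting it from \<open>frame_vec i\<close> keeps the
    inner products with \<open>H\<close> but reduces the norm to the sharp value
    \<open>sqrt (real k / K)\<close>.\<close>
  define m where "m = (1 / K) *\<^sub>R (\<Sum>w\<in>W. frame_vec w)"
  have mb: "m \<bullet> frame_vec w = 1 / K - 1 / real (card V)" if "w \<in> W" for w
  proof -
    have "(\<Sum>x\<in>W. frame_vec x \<bullet> frame_vec w) = (\<Sum>x\<in>W. (if x = w then 1 else 0) - 1 / real (card V))"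
      using W(1) that by (intro sum.cong inner_frame_vec) auto
    also have "\<dots> = 1 - K / real (card V)"
      using finW that K by (simp add: sum_subtractf)
    finally show ?thesis
      using K by (simp add: m_def inner_sum_left field_simps)
  qed
  have mm: "m \<bullet> m = 1 / K - 1 / real (card V)"
  proof -
    have "m \<bullet> m = (1 / K) * (\<Sum>w\<in>W. m \<bullet> frame_vec w)"
      by (subst (2) m_def) (simp add: inner_sum_right)
    then show ?thesis using mb K by simp
  qed
  have r_pos: "r > 0" using scale_pos k by (simp add: r)
  define B where "B = {x. (\<Sum>j=1..k. ((x - y) \<bullet> v j)\<^sup>2) \<le> r\<^sup>2 \<and>
                (\<forall>j\<in>{k+1..DIM('a)}. (x - y) \<bullet> v j = 0)}"
  have "euclidean_ball k r B"
    unfolding euclidean_ball_def using r_pos v(1) B_def by blast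
  moreover have "x \<in> convex hull W" if x: "x \<in> B" for x
  proof -
    define u where "u = x - y"
    have kn: "k \<le> DIM('a)"
      using card_mono[OF fin W(1)] W(2) card_V by simp
    have u0: "u \<bullet> v j = 0" if "j \<in> {1..DIM('a)} - {1..k}" for j
      using x that by (auto simp: B_def u_def)
    have "u = (\<Sum>j=1..k. (u \<bullet> v j) *\<^sub>R v j)"
      using orthonormal_basis_expansion[OF v(1), of u] u0 kn
        sum.mono_neutral_left[of "{1..DIM('a)}" "{1..k}" "\<lambda>j. (u \<bullet> v j) *\<^sub>R v j"] by auto
    also have "\<dots> \<in> H"
      unfolding H_def using v(2) by (intro span_sum span_mul) (auto simp: H_def)
    finally have uH: "u \<in> H" .
    have "(norm u)\<^sup>2 = (\<Sum>j=1..k. (u \<bullet> v j)\<^sup>2)"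
      unfolding orthonormal_basis_norm[OF v(1), symmetric]
      using u0 kn by (intro sum.mono_neutral_right) auto
    then have "(norm u)\<^sup>2 \<le> r\<^sup>2"
      using x by (simp add: B_def u_def)
    then have nu: "norm u \<le> r"
      using r_pos by (simp add: power2_le_iff_abs_le)
    have bx: "bary i x = bary i y + scale * (frame_vec i \<bullet> u)" for i
      using bary_add[of i y u] by (simp add: u_def)
    have out: "bary i x = 0" if "i \<in> V - W" for i
    proof -
      have "frame_vec i \<bullet> u = 0"
        using uH by (rule orthH[where c = "- (1 / real (card V))"]) (use that W(1) in \<open>auto simp: inner_frame_vec\<close>)
      then show ?thesis using bx y that by simp
    qed
    have ins: "0 \<le> bary i x" if "i \<in> W" for i
    proof -
      have iV: "i \<in> V" using that W(1) by blast
      have "m \<bullet> u = 0" using uH mb by (rule orthH)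
      then have "frame_vec i \<bullet> u = (frame_vec i - m) \<bullet> u" by (simp add: inner_diff_left)
      moreover have "\<bar>(frame_vec i - m) \<bullet> u\<bar> \<le> norm (frame_vec i - m) * r"
        using Cauchy_Schwarz_ineq2[of "frame_vec i - m" u] mult_left_mono[OF nu norm_ge_zero] by (rule order_trans)
      moreover have "(frame_vec i - m) \<bullet> (frame_vec i - m) = 1 - 1 / K"
        using mb[OF that] mm inner_frame_vec[OF iV iV]
        by (simp add: inner_diff_left inner_diff_right inner_commute)
      then have "norm (frame_vec i - m) = sqrt (real k / K)"
        using K(1) by (simp add: norm_eq_sqrt_inner K_def field_simps)
      ultimately have "scale * (frame_vec i \<bullet> u) \<ge> scale * (- (sqrt (real k / K) * r))"
        using scale_pos by (intro mult_left_mono) auto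
      \<comment> \<open>By the choice of \<open>r\<close>, the largest possible loss is exactly the
        value \<open>1 / K\<close> of the coordinate at the centre.\<close>
      also have "scale * (- (sqrt (real k / K) * r)) = - (1 / K)"
        using scale_pos k K(1) unfolding r K_def[symmetric]
        by (simp add: real_sqrt_divide real_sqrt_mult)
      finally show ?thesis using bx[of i] y[OF iV] that by simp
    qed
    show ?thesis
      unfolding mem_face_iff[OF W(1)] using ins out by force
  qed
  ultimately show ?thesis by blast
qed

text \<open>The case \<open>k = DIM('a)\<close> is included because it expresses the internal radius
  through \<open>scale\<close>.\<close>

lemma max_ball_radius_simplex:
  assumes k: "0 < k" "k \<le> DIM('a)"
  shows "max_ball_radius k (convex hull V) (1 / (scale * sqrt (real k * (real k + 1))))"
    (is "max_ball_radius _ _ ?R")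
  unfolding max_ball_radius_def
proof (intro conjI allI impI)
  obtain W where W: "W \<subseteq> V" "card W = k + 1"
    using obtain_subset_with_card_n[of "k + 1" V] k card_V by auto
  then show "\<exists>B. euclidean_ball k ?R B \<and> B \<subseteq> convex hull V"
    using face_contains_ball[OF W k(1) refl] hull_mono[OF W(1)] by blast
  fix s B assume "euclidean_ball k s B \<and> B \<subseteq> convex hull V"
  then show "s \<le> ?R"
    using ball_radius_le[of k s B] k scale_pos by (simp add: pos_le_divide_eq mult_ac)
qed

end

section \<open>Normalisation by the internal radius\<close>

lemma max_ball_radius_unique:
  assumes "max_ball_radius k T r" "max_ball_radius k T s"
  shows "r = s"
  using assms unfolding max_ball_radius_def by (meson order_antisym)

theorem proposition2:
  fixes V T :: "(real ^ 'n) set" and k n :: nat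
  assumes "n = CARD('n)" and "n \<ge> 2"
    and "regular_simplex_vertices V" and "T = convex hull V"
    and "has_internal_radius T 1"
    and "1 \<le> k" and "k \<le> n - 1"
  shows "max_ball_radius k T (sqrt ((real n * (real n + 1)) / (real k * (real k + 1)))) \<and>
    (\<forall>B r. euclidean_ball k r B \<and> B \<subseteq> T \<longrightarrow>
       (max_ball_radius k T r \<longleftrightarrow>
          r = sqrt ((real n * (real n + 1)) / (real k * (real k + 1))) \<and>
          (\<exists>F. simplex_face V k F \<and> B \<subseteq> F)))"
proof -
  obtain d where d: "d > 0" "\<forall>x\<in>V. \<forall>y\<in>V. x \<noteq> y \<longrightarrow> dist x y = d"
    using assms(3) unfolding regular_simplex_vertices_def by blast
  interpret regular_simplex V d
    using assms(3) d by unfold_locales (auto simp: regular_simplex_vertices_def)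
  have n: "DIM(real ^ 'n) = n" using assms(1) by simp
  have k: "0 < k" "k \<le> DIM(real ^ 'n)" using assms(6,7) unfolding n by auto
  \<comment> \<open>The full-dimensional case, compared with internal radius 1, determines
    \<open>scale\<close> and thus removes the edge length from the formula for
    \<open>k\<close>.\<close>
  have "max_ball_radius n T (1 / (scale * sqrt (real n * (real n + 1))))"
    using max_ball_radius_simplex[of n] assms(2,4) n by simp
  then have "1 = 1 / (scale * sqrt (real n * (real n + 1)))"
    using assms(5) max_ball_radius_unique unfolding n by blast
  then have inv_scale: "1 / scale = sqrt (real n * (real n + 1))"
    using scale_pos by (simp add: field_simps split: if_splits)
  define R where "R = sqrt ((real n * (real n + 1)) / (real k * (real k + 1)))"
  have R: "R = 1 / (scale * sqrt (real k * (real k + 1)))"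
    unfolding R_def real_sqrt_divide inv_scale[symmetric] by simp
  have max: "max_ball_radius k T R"
    using max_ball_radius_simplex[OF k] assms(4) by (simp add: R)
  have "max_ball_radius k T r \<longleftrightarrow> r = R \<and> (\<exists>F. simplex_face V k F \<and> B \<subseteq> F)"
    if B: "euclidean_ball k r B" "B \<subseteq> T" for B r
  proof
    assume "max_ball_radius k T r"
    then have r: "r = R" using max by (rule max_ball_radius_unique)
    then have "scale * r * sqrt (real k * (real k + 1)) = 1"
      using scale_pos k(1) by (simp add: R)
    then show "r = R \<and> (\<exists>F. simplex_face V k F \<and> B \<subseteq> F)"
      using ball_in_face[OF B(1) _ k(2,1)] B(2) assms(4) r unfolding simplex_face_def by blast
  qed (use max in simp)
  with max show ?thesis unfolding R_def by blast
qed

end
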